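(* Let $f\ge1$ be an integer. For $1\le i\le f+1$ let $y_i(a,q;x)$ be the generating function of generalized Schröder paths under the line $y=\frac xf$ from $(0,0)$ to $(fl+i-1,l)$, $l\ge0$, and let $\overline{P}^{T_{1,f}}(a,q;x)$ be the generating function of superpolynomials of the unreduced colored HOMFLY-PT homology of the torus knot $T_{1,f}$ (both defined in the context). Then $$y_i(a,q;x)=\frac{\overline{P}^{T_{1,f}}(a,q;q^{2i-1}x)}{\overline{P}^{T_{1,f}}(a,q;q^{-1}x)},\qquad 1\le i\le f+1 .$$
   Context: **Paths.** $\mathbb{N}=\{0,1,2,\dots\}$. For $i,j,l\in\mathbb{N}$ and $k\in\mathbb{Z}_{\ge1}$, $n_{i,j,l;k}$ is the number of lattice paths from $(0,0)$ to $(fl+k-1,l)$ with right steps $(1,0)$, up steps $(0,1)$ and exactly $\frac i2$ diagonal steps $(1,1)$, continued by infinitely many right steps after $(fl+k-1,l)$, that never go above the line $y=\frac xf$ and such that the area enclosed by the path, the line $y=\frac xf$ and the line $y=l$ is $\frac j2$. Set $y_k(a,q;x):=\sum_{i,j,l\in\mathbb{N}}n_{i,j,l;k}\,a^iq^jx^l$. **Superpolynomials.** The generating function is $$\overline{P}^{T_{1,f}}(a,q;x)=\sum_{r\ge0}\overline{P}^{T_{1,f}}_r(a,q)x^r:=1+\sum_{r\ge1}(-1)^r\frac{\prod_{i=1}^r(a^2+q^{2i-1})}{\prod_{i=1}^r(1-q^{2i})}\,q^{fr^2}\,\mathcal{P}^{T_{1,f}}_r(a,1,q^{-1})\,x^r,$$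 where $\mathcal{P}^{T_{1,f}}_r(a,q,t)$, $r\ge1$, are the superpolynomials of the reduced colored HOMFLY-PT homology. For the torus knot $T_{1,f}$ the coefficients $\overline{P}^{T_{1,f}}_r(a,q)$ are determined by $\overline{P}^{T_{1,f}}_0(a,q)=1$ and $$\overline{P}^{T_{1,f}}_{r+1}(a,q)=-q^{(2r+1)f}\cdot\frac{a^2+q^{2r+1}}{1-q^{2r+2}}\cdot\overline{P}^{T_{1,f}}_r(a,q),\qquad r\ge0,$$ and this may be taken as the definition of $\overline{P}^{T_{1,f}}$. The identity is one of formal power series in $x$, with rational functions of $q$ expanded as power series in $q$ where needed. *)

theory Defs
  imports
    "HOL-Analysis.Analysis"
    "HOL-Computational_Algebra.Formal_Laurent_Series"
begin

section \<open>Generalized Schroeder paths\<close>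

datatype step = Rightstep | Upstep | Diagstep

fun displacement :: "step \<Rightarrow> real \<times> real" where
  "displacement Rightstep = (1, 0)"
| "displacement Upstep = (0, 1)"
| "displacement Diagstep = (1, 1)"

definition path_vertex :: "step list \<Rightarrow> nat \<Rightarrow> real \<times> real" where
  "path_vertex p m = (\<Sum>s\<leftarrow>take m p. displacement s)"

definition path_end :: "step list \<Rightarrow> real \<times> real" where
  "path_end p = path_vertex p (length p)"

text \<open>The list \<open>p\<close> records the finite part of the path only; the infinitely many right steps
  that follow it contribute the horizontal ray starting at \<open>path_end p\<close>.\<close>

definition path_trace :: "step list \<Rightarrow> (real \<times> real) set" where
  "path_trace p =
     (\<Union>m<length p. closed_segment (path_vertex p m) (path_vertex p (Suc m))) \<union>
     {path_end p + (t, 0) |t. t \<ge> 0}"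

definition stays_below :: "nat \<Rightarrow> step list \<Rightarrow> bool" where
  "stays_below f p \<longleftrightarrow> (\<forall>(x, y) \<in> path_trace p. y \<le> x / real f)"

text \<open>The points not above the line \<open>y = x/f\<close>, not above the line \<open>y = l\<close>, and on or above the
  path. For a path ending at height \<open>l\<close> this region is bounded up to a part of the line \<open>y = l\<close>,
  which is a null set.\<close>

definition enclosed_region :: "nat \<Rightarrow> nat \<Rightarrow> step list \<Rightarrow> (real \<times> real) set" where
  "enclosed_region f l p =
     {(x, y). y \<le> x / real f \<and> y \<le> real l \<and> (\<exists>y'\<le>y. (x, y') \<in> path_trace p)}"

definition enclosed_area :: "nat \<Rightarrow> nat \<Rightarrow> step list \<Rightarrow> real" where
  "enclosed_area f l p = measure lebesgue (enclosed_region f l p)"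

definition schroeder_paths :: "nat \<Rightarrow> nat \<Rightarrow> nat \<Rightarrow> nat \<Rightarrow> nat \<Rightarrow> step list set" where
  "schroeder_paths f k i j l =
     {p. path_end p = (real f * real l + real k - 1, real l) \<and>
         real (count_list p Diagstep) = real i / 2 \<and>
         stays_below f p \<and>
         enclosed_area f l p = real j / 2}"

definition num_schroeder_paths :: "nat \<Rightarrow> nat \<Rightarrow> nat \<Rightarrow> nat \<Rightarrow> nat \<Rightarrow> nat" where
  "num_schroeder_paths f k i j l = card (schroeder_paths f k i j l)"

section \<open>Generating functions\<close>

text \<open>All series live in \<open>\<rat>((a))((q))[[x]]\<close>. The coefficient ring \<open>\<rat>((a))((q))\<close> is a field
  containing the rational functions of \<open>a\<close> and \<open>q\<close>; in it the inverse of \<open>1 - q^m\<close> is its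
  expansion as a power series in \<open>q\<close>.\<close>

type_synonym coeff = "rat fls fls"

definition a_var :: coeff where "a_var = fls_const fls_X"

definition q_var :: coeff where "q_var = fls_X"

text \<open>The series whose coefficient of \<open>a^i q^j x^l\<close> is the number of paths with
  \<open>i/2\<close> diagonal steps, area \<open>j/2\<close> and final height \<open>l\<close>.\<close>

definition schroeder_gf :: "nat \<Rightarrow> nat \<Rightarrow> coeff fps" where
  "schroeder_gf f k =
     Abs_fps (\<lambda>l. fps_to_fls (Abs_fps (\<lambda>j. fps_to_fls (Abs_fps (\<lambda>i.
       of_nat (num_schroeder_paths f k i j l))))))"

primrec superpoly_coeff :: "nat \<Rightarrow> nat \<Rightarrow> coeff" where
  "superpoly_coeff f 0 = 1"
| "superpoly_coeff f (Suc r) =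
     - (q_var ^ ((2 * r + 1) * f)) *
     ((a_var ^ 2 + q_var ^ (2 * r + 1)) / (1 - q_var ^ (2 * r + 2))) *
     superpoly_coeff f r"

definition superpoly_gf :: "nat \<Rightarrow> coeff fps" where
  "superpoly_gf f = Abs_fps (superpoly_coeff f)"

end

theory Submission
  imports Defs
begin

text \<open>Write \<open>y k\<close> for the generating function of paths to \<open>(f l + k - 1, l)\<close> and \<open>E k\<close> for the
  superpolynomial series evaluated at \<open>q^(2k-1) x\<close>. The claim is \<open>y k * E 0 = E k\<close>, and it holds
  because both sides solve the same linear recursion in \<open>k\<close>.

  On the side of the paths, remove the last step. Measure the position of a point by its horizontal
  distance \<open>d = x - f y\<close> to the line, which is \<open>k - 1\<close> at the end of the path. A right step
  raises \<open>d\<close> by one and encloses no area, because the path is continued to the right anyway. An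
  up step lowers \<open>d\<close> by \<open>f\<close> and a diagonal step by \<open>f - 1\<close>; either adds the trapezoid between
  the line and the step, whose doubled area is \<open>2 d + f\<close> or \<open>2 d + f - 1\<close> when the step ends at
  distance \<open>d\<close>. Hence, up to the empty path for \<open>k = 0\<close>,
  \<open>y (k+1) = y k + x (q^(2k+f) y (k+1+f) + a^2 q^(2k+f-1) y (k+f))\<close>
  (lemma \<open>schroeder_gf_Suc\<close>). The series \<open>E k\<close> satisfy the same equation, which is the recursion
  for the superpolynomials multiplied by its denominator (lemma \<open>scaled_superpoly_Suc\<close>).

  The factor \<open>x\<close> makes a solution with given value at \<open>k = 0\<close> unique
  (lemma \<open>fps_recursion_zero\<close>), and at \<open>k = 0\<close> both sides can be matched: no admissible path
  ends above the line, so \<open>y 0 = 0\<close>, and counting the empty path there instead gives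
  \<open>1 * E 0 = E 0\<close>.

  The geometric part is the area. Horizontal slabs are used since the region enclosed by a path is,
  up to null sets, the region enclosed without the last step together with one trapezoid
  (lemma \<open>enclosed_region_rising_step\<close>).\<close>

section \<open>The trace of a path and its last step\<close>

definition path_segments :: "step list \<Rightarrow> (real \<times> real) set" where
  "path_segments p =
     (\<Union>m<length p. closed_segment (path_vertex p m) (path_vertex p (Suc m)))"

lemma path_trace_eq:
  "path_trace p = path_segments p \<union> {path_end p + (t, 0) |t. t \<ge> 0}"
  by (simp add: path_trace_def path_segments_def)

lemma path_segments_Nil [simp]: "path_segments [] = {}"
  by (simp add: path_segments_def)

lemma path_end_Nil [simp]: "path_end [] = (0, 0)"
  by (simp add: path_end_def path_vertex_def zero_prod_def)

lemma path_end_snoc: "path_end (p @ [s]) = path_end p + displacement s"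
  by (simp add: path_end_def path_vertex_def)

lemma path_segments_snoc:
  "path_segments (p @ [s]) =
     path_segments p \<union> closed_segment (path_end p) (path_end p + displacement s)"
proof -
  have old: "path_vertex (p @ [s]) m = path_vertex p m" if "m \<le> length p" for m
    using that by (simp add: path_vertex_def)
  have "path_vertex (p @ [s]) (Suc (length p)) = path_end p + displacement s"
    using path_end_snoc[of p s] by (simp add: path_end_def)
  then show ?thesis
    unfolding path_segments_def
    by (auto simp: lessThan_Suc old path_end_def)
qed

lemma closed_segment_add:
  fixes z w :: "'a::real_vector"
  shows "closed_segment z (z + w) = {z + t *\<^sub>R w |t. 0 \<le> t \<and> t \<le> 1}"
  unfolding closed_segment_def by (auto simp: algebra_simps intro!: exI)

lemma path_end_nonneg: "0 \<le> fst (path_end p)" "0 \<le> snd (path_end p)"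
proof (induction p rule: rev_induct)
  case (snoc s p)
  { case 1 then show ?case using snoc by (cases s) (auto simp: path_end_snoc) }
  { case 2 then show ?case using snoc by (cases s) (auto simp: path_end_snoc) }
qed auto

lemma length_le_path_end: "real (length p) \<le> fst (path_end p) + snd (path_end p)"
proof (induction p rule: rev_induct)
  case (snoc s p)
  then show ?case by (cases s) (auto simp: path_end_snoc)
qed auto

text \<open>No step goes left or down, so the finite part of a path lies in the quadrant below and to the
  left of its end. Hence a further step leaves the region below the height of that end
  unchanged.\<close>

lemma path_segments_le_end:
  "(x, y) \<in> path_segments p \<Longrightarrow> x \<le> fst (path_end p) \<and> y \<le> snd (path_end p)"
proof (induction p arbitrary: x y rule: rev_induct)
  case (snoc s p)
  from snoc.prems consider "(x, y) \<in> path_segments p"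
    | t where "0 \<le> t" "t \<le> 1" "(x, y) = path_end p + t *\<^sub>R displacement s"
    by (auto simp: path_segments_snoc closed_segment_add)
  then show ?case
  proof cases
    case 1
    then show ?thesis using snoc.IH by (cases s) (fastforce simp: path_end_snoc)+
  next
    case 2
    then show ?thesis
      by (cases s; cases "path_end p") (auto simp: path_end_snoc)
  qed
qed auto

text \<open>The path is connected, so it meets every vertical line between its start and its end. This
  makes the region between the path and the line contain every point of a horizontal slab that
  lies between the line and the last step.\<close>

lemma path_segments_cover:
  "0 \<le> x \<Longrightarrow> x < fst (path_end p) \<Longrightarrow> \<exists>y. (x, y) \<in> path_segments p"
proof (induction p rule: rev_induct)
  case (snoc s p)
  obtain X c where e: "path_end p = (X, c)" by fastforce
  show ?case
  proof (cases "x < X")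
    case True
    then show ?thesis using snoc e by (auto simp: path_segments_snoc)
  next
    case False
    have "x \<le> X + 1" "s \<noteq> Upstep"
      using snoc.prems False by (cases s; auto simp: path_end_snoc e)+
    then have "path_end p + (x - X) *\<^sub>R displacement s = (x, c + (x - X) * snd (displacement s))"
      by (cases s) (auto simp: e)
    then have "(x, c + (x - X) * snd (displacement s)) \<in>
        closed_segment (path_end p) (path_end p + displacement s)"
      using False \<open>x \<le> X + 1\<close> unfolding closed_segment_add
      by (auto intro!: exI[of _ "x - X"])
    then show ?thesis by (auto simp: path_segments_snoc)
  qed
qed auto

text \<open>A final right step is absorbed in the horizontal ray that follows the path anyway. Such a step
  therefore changes neither the constraint nor the area.\<close>

lemma path_trace_snoc_Rightstep: "path_trace (p @ [Rightstep]) = path_trace p"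
proof -
  obtain X c where e: "path_end p = (X, c)" by fastforce
  have "{(X + t, c) |t. 0 \<le> t \<and> t \<le> 1} \<union> {(X + 1 + t, c) |t. t \<ge> 0} = {(X + t, c) |t. t \<ge> 0}"
    (is "?L = ?R")
  proof
    show "?L \<subseteq> ?R" by (auto intro: exI[of _ "1 + _"])
    show "?R \<subseteq> ?L"
    proof
      fix z assume "z \<in> ?R"
      then obtain t where t: "z = (X + t, c)" "0 \<le> t" by blast
      then have "z = (X + 1 + (t - 1), c)" by simp
      then show "z \<in> ?L" using t by (cases "t \<le> 1") (blast, fastforce)
    qed
  qed
  moreover have "closed_segment (X, c) (X + 1, c) = {(X + t, c) |t. 0 \<le> t \<and> t \<le> 1}"
    using closed_segment_add[of "(X, c)" "(1, 0)"] by simp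
  ultimately show ?thesis
    by (simp add: path_trace_eq path_segments_snoc path_end_snoc e Un_assoc)
qed

definition half_plane :: "nat \<Rightarrow> (real \<times> real) set" where
  "half_plane f = {(x, y). y \<le> x / real f}"

text \<open>The ray moves away from the line, and so stays below it as soon as its starting point does.\<close>

lemma stays_below_iff:
  "stays_below f p \<longleftrightarrow> path_segments p \<subseteq> half_plane f \<and> path_end p \<in> half_plane f"
proof -
  obtain X c where e: "path_end p = (X, c)" by fastforce
  have "c \<le> (X + t) / real f" if "c \<le> X / real f" "0 \<le> t" for t
    using that by (smt (verit) divide_right_mono of_nat_0_le_iff)
  then have "{(X + t, c) |t. t \<ge> 0} \<subseteq> half_plane f \<longleftrightarrow> (X, c) \<in> half_plane f"
    by (auto simp: half_plane_def intro!: exI[of _ 0] dest: subsetD[of _ _ "(X, c)"])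
  then show ?thesis
    by (auto simp: stays_below_def path_trace_eq e half_plane_def)
qed

lemma convex_half_plane: "convex (half_plane f)"
proof -
  have "half_plane f = {z. (- 1 / real f, 1) \<bullet> z \<le> 0}"
    by (auto simp: half_plane_def)
  then show ?thesis by (metis convex_halfspace_le)
qed

text \<open>By convexity of the half plane, it is enough to look at vertices.\<close>

lemma stays_below_snoc:
  "stays_below f (p @ [s]) \<longleftrightarrow> stays_below f p \<and> path_end (p @ [s]) \<in> half_plane f"
  unfolding stays_below_iff path_segments_snoc path_end_snoc
  using closed_segment_subset[OF _ _ convex_half_plane] by fastforce

section \<open>The area gained by an up step or a diagonal step\<close>

text \<open>The slab lies between the line \<open>x = f y\<close> and a step from \<open>(X, c)\<close> to \<open>(X + s, c + 1)\<close>. Its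
  area is the integral over \<open>y\<close> of the lengths of its horizontal sections.\<close>

lemma slab_measure:
  fixes X c f s :: real
  assumes "\<And>y. c \<le> y \<Longrightarrow> y \<le> c + 1 \<Longrightarrow> f * y \<le> X + s * (y - c)"
  defines "T \<equiv> {(x, y). c \<le> y \<and> y \<le> c + 1 \<and> f * y \<le> x \<and> x \<le> X + s * (y - c)}"
  shows "T \<in> lmeasurable" "measure lebesgue T = X + s / 2 - f * (c + 1 / 2)"
proof -
  have "closed T"
    unfolding T_def case_prod_beta
    by (intro closed_Collect_conj closed_Collect_le continuous_intros)
  then have TB: "T \<in> sets borel" by simp
  let ?h = "\<lambda>y. X + s * (y - c) - f * y"
  have slice: "emeasure lborel ((\<lambda>x. (x, y)) -` T) = ennreal (?h y) * indicator {c..c+1} y" for y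
  proof (cases "y \<in> {c..c+1}")
    case True
    then have "(\<lambda>x. (x, y)) -` T = {f * y..X + s * (y - c)}"
      by (auto simp: T_def)
    then show ?thesis using True assms(1)[of y] by simp
  next
    case False
    then have "(\<lambda>x. (x, y)) -` T = {}" by (auto simp: T_def)
    then show ?thesis using False by simp
  qed
  define H where "H y = X * y + s * (y^2 / 2 - c * y) - f * y^2 / 2" for y
  have "emeasure lborel T = emeasure (lborel \<Otimes>\<^sub>M lborel) T"
    by (simp add: lborel_prod)
  also have "\<dots> = (\<integral>\<^sup>+y. emeasure lborel ((\<lambda>x. (x, y)) -` T) \<partial>lborel)"
    by (rule lborel_pair.emeasure_pair_measure_alt2) (use TB in \<open>simp only: lborel_prod sets_lborel\<close>)
  also have "\<dots> = (\<integral>\<^sup>+y. ennreal (?h y) * indicator {c..c+1} y \<partial>lborel)"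
    by (simp only: slice)
  also have "\<dots> = ennreal (H (c + 1) - H c)"
  proof (rule nn_integral_FTC_Icc)
    show "(H has_real_derivative ?h y) (at y)" for y
      unfolding H_def by (auto intro!: derivative_eq_intros simp: algebra_simps)
    show "0 \<le> ?h y" if "y \<in> {c..c + 1}" for y
      using that assms(1)[of y] by simp
  qed auto
  also have "H (c + 1) - H c = X + s / 2 - f * (c + 1 / 2)"
    by (simp add: H_def power2_eq_square field_simps)
  finally have em: "emeasure lborel T = ennreal (X + s / 2 - f * (c + 1 / 2))" .
  have nn: "0 \<le> X + s / 2 - f * (c + 1 / 2)"
    using assms(1)[of "c + 1 / 2"] by (simp add: algebra_simps)
  show "T \<in> lmeasurable"
    using TB em by (intro fmeasurableI) auto
  show "measure lebesgue T = X + s / 2 - f * (c + 1 / 2)"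
    using TB em nn by (simp add: measure_completion measure_def)
qed

lemma negligible_horizontal_line: "negligible {(x::real, y). y = (c::real)}"
proof -
  have "negligible {z::real \<times> real. z \<bullet> (0, 1) = c}"
    by (rule negligible_standard_hyperplane) (auto simp: Basis_prod_def)
  then show ?thesis by (rule negligible_subset) auto
qed

text \<open>Cutting at the height \<open>l\<close> of the old end point, the new region is the old one below the cut and
  a trapezoid above it, between the line and the last step. The two descriptions differ only on
  the two horizontal lines that bound the slab, where the rays of the old and the new path run;
  these lines are null sets. The width \<open>\<sigma>\<close> of the step is \<open>0\<close> for an up step and \<open>1\<close> for a
  diagonal step.\<close>

lemma enclosed_region_rising_step:
  assumes f: "f \<ge> 1" and below: "stays_below f (p @ [s])"
    and s: "displacement s = (\<sigma>, 1)"
    and e: "path_end p = (X, real l)"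
    and meas: "enclosed_region f l p \<in> lmeasurable"
  shows "enclosed_region f (Suc l) (p @ [s]) \<in> lmeasurable"
    and "enclosed_area f (Suc l) (p @ [s]) =
           enclosed_area f l p + X + \<sigma> / 2 - real f * (real l + 1 / 2)"
proof -
  define c where "c = real l"
  define old where "old = enclosed_region f l p"
  define new where "new = enclosed_region f (Suc l) (p @ [s])"
  define T where "T = {(x, y). c \<le> y \<and> y \<le> c + 1 \<and> real f * y \<le> x \<and> x \<le> X + \<sigma> * (y - c)}"
  define L where "L = {(x::real, y). y = c} \<union> {(x::real, y). y = c + 1}"
  have \<sigma>: "0 \<le> \<sigma>" using s by (cases s) auto
  have ce: "path_end p = (X, c)" by (simp add: e c_def)
  have c0: "0 \<le> c" by (simp add: c_def)
  have fle: "y \<le> x / real f \<longleftrightarrow> real f * y \<le> x" for x y :: real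
    using f by (simp add: field_simps)
  have le1: "real f * c \<le> X" and le2: "real f * (c + 1) \<le> X + \<sigma>"
    using below[unfolded stays_below_snoc stays_below_iff[of f p]]
    by (simp_all add: half_plane_def ce path_end_snoc s fle)
  \<comment> \<open>Both ends of the step satisfy the inequality, which is affine in \<open>y\<close>.\<close>
  have slab: "real f * y \<le> X + \<sigma> * (y - c)" if "c \<le> y" "y \<le> c + 1" for y
  proof -
    have "0 \<le> (1 - (y - c)) * (X - real f * c) + (y - c) * (X + \<sigma> - real f * (c + 1))"
      using that le1 le2 by (intro add_nonneg_nonneg mult_nonneg_nonneg) auto
    then show ?thesis by (simp add: algebra_simps)
  qed
  have T: "T \<in> lmeasurable" "measure lebesgue T = X + \<sigma> / 2 - real f * (c + 1 / 2)"
    using slab_measure[OF slab] unfolding T_def by auto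
  have segs: "x \<le> X \<and> y \<le> c" if "(x, y) \<in> path_segments p" for x y
    using path_segments_le_end[OF that] by (simp add: ce)
  have trace: "(x, y) \<in> path_trace p \<longleftrightarrow> (x, y) \<in> path_segments p \<or> (X \<le> x \<and> y = c)" for x y
    by (auto simp: path_trace_eq ce intro: exI[of _ "x - X"])
  have trace': "(x, y) \<in> path_trace (p @ [s]) \<longleftrightarrow> (x, y) \<in> path_segments p \<or>
      (\<exists>t. 0 \<le> t \<and> t \<le> 1 \<and> x = X + t * \<sigma> \<and> y = c + t) \<or> (X + \<sigma> \<le> x \<and> y = c + 1)" for x y
  proof -
    have "closed_segment (X, c) (X + \<sigma>, c + 1) = {(X + t * \<sigma>, c + t) |t. 0 \<le> t \<and> t \<le> 1}"
      using closed_segment_add[of "(X, c)" "(\<sigma>, 1)"] by simp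
    then show ?thesis
      by (auto simp: path_trace_eq path_end_snoc path_segments_snoc ce s
          intro: exI[of _ "x - X - \<sigma>"])
  qed
  \<comment> \<open>Off the two bounding lines neither ray matters: only the finite part is seen below height
    \<open>c\<close>, and only the last step is added between the heights \<open>c\<close> and \<open>c + 1\<close>.\<close>
  have iff: "(x, y) \<in> new \<longleftrightarrow> (x, y) \<in> old \<union> T" if ne: "y \<noteq> c" "y \<noteq> c + 1" for x y
  proof
    assume "(x, y) \<in> new"
    then obtain y' where y: "real f * y \<le> x" "y \<le> c + 1" "y' \<le> y" "(x, y') \<in> path_trace (p @ [s])"
      by (auto simp: new_def enclosed_region_def fle c_def)
    show "(x, y) \<in> old \<union> T"
    proof (cases "y < c")
      case True
      then have "(x, y') \<in> path_segments p" using y(3,4) by (auto simp: trace')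
      then have "(x, y) \<in> old"
        using y(1,3) True by (auto simp: old_def enclosed_region_def fle c_def path_trace_eq)
      then show ?thesis by simp
    next
      case False
      have "x \<le> X + \<sigma> * (y - c)"
      proof -
        consider "(x, y') \<in> path_segments p"
          | t where "0 \<le> t" "t \<le> 1" "x = X + t * \<sigma>" "y' = c + t"
          using y ne by (auto simp: trace')
        then show ?thesis
        proof cases
          case 1
          then show ?thesis using segs[OF 1] \<sigma> False
            by (smt (verit) mult_nonneg_nonneg)
        next
          case 2
          then show ?thesis using y(3) \<sigma> mult_right_mono[of t "y - c" \<sigma>]
            by (simp add: mult.commute)
        qed
      qed
      then show ?thesis using y False by (simp add: T_def)
    qed
  next
    assume "(x, y) \<in> old \<union> T"
    then show "(x, y) \<in> new"
    proof
      assume "(x, y) \<in> old"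
      then obtain y' where y: "real f * y \<le> x" "y \<le> c" "y' \<le> y" "(x, y') \<in> path_trace p"
        by (auto simp: old_def enclosed_region_def fle c_def)
      then have "(x, y') \<in> path_segments p" using ne by (auto simp: trace)
      then show ?thesis
        using y by (auto simp: new_def enclosed_region_def fle c_def trace')
    next
      assume "(x, y) \<in> T"
      then have y: "c \<le> y" "y \<le> c + 1" "real f * y \<le> x" "x \<le> X + \<sigma> * (y - c)"
        by (auto simp: T_def)
      have "\<exists>y'\<le>y. (x, y') \<in> path_trace (p @ [s])"
      proof (cases "x < X")
        case True
        have "0 \<le> x" using y(1,3) c0 by (smt (verit) mult_nonneg_nonneg of_nat_0_le_iff)
        then obtain y' where "(x, y') \<in> path_segments p"
          using path_segments_cover[of x p] True by (auto simp: ce)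
        then show ?thesis using segs[of x y'] y(1) by (auto simp: trace' intro!: exI[of _ y'])
      next
        case False
        show ?thesis
        proof (cases "\<sigma> = 0")
          case True
          then have "x = X" using y(4) False by simp
          then have "(x, c) \<in> path_trace (p @ [s])"
            by (auto simp: trace' intro!: exI[of _ 0])
          then show ?thesis using y(1) by blast
        next
          case False
          with \<sigma> have pos: "0 < \<sigma>" by simp
          define t where "t = (x - X) / \<sigma>"
          have t: "x = X + t * \<sigma>" using pos by (simp add: t_def)
          have "0 \<le> t" using \<open>\<not> x < X\<close> pos by (simp add: t_def)
          moreover have "t \<le> y - c"
            using y(4) pos by (simp add: t_def field_simps)
          ultimately have "(x, c + t) \<in> path_trace (p @ [s])" "c + t \<le> y"
            using y(2) t by (auto simp: trace')
          then show ?thesis by blast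
        qed
      qed
      then show ?thesis using y by (auto simp: new_def enclosed_region_def fle c_def)
    qed
  qed
  have L: "negligible L"
    unfolding L_def by (intro negligible_Un negligible_horizontal_line)
  have "negligible ((old \<union> T - new) \<union> (new - (old \<union> T)))"
    by (rule negligible_subset[OF L]) (use iff in \<open>auto simp: L_def\<close>)
  moreover have oT: "old \<union> T \<in> lmeasurable"
    using meas T(1) by (auto simp: old_def)
  ultimately have new: "new \<in> lmeasurable" "measure lebesgue new = measure lebesgue (old \<union> T)"
    by (metis lmeasurable_negligible_symdiff, metis measure_negligible_symdiff)
  then show "enclosed_region f (Suc l) (p @ [s]) \<in> lmeasurable"
    by (simp add: new_def)
  have "negligible (old \<inter> T)"
    by (rule negligible_subset[OF L])
      (auto simp: old_def T_def L_def enclosed_region_def c_def)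
  then have "measure lebesgue (old \<union> T) = measure lebesgue old + measure lebesgue T"
    using meas T(1) by (simp add: measure_Un3 old_def negligible_imp_measure0)
  then show "enclosed_area f (Suc l) (p @ [s]) =
           enclosed_area f l p + X + \<sigma> / 2 - real f * (real l + 1 / 2)"
    using new T(2) by (simp add: enclosed_area_def new_def old_def c_def)
qed

section \<open>Counting paths by their last step\<close>

lemma rising_last_stepE:
  assumes "path_end (p @ [s]) = (X, real l)" and "displacement s = (\<sigma>, 1)"
  obtains l' where "l = Suc l'" and "path_end p = (X - \<sigma>, real l')"
proof (cases l)
  case 0
  then show ?thesis using assms path_end_nonneg(2)[of p]
    by (cases "path_end p") (auto simp: path_end_snoc)
next
  case (Suc l')
  then show ?thesis using assms that
    by (cases "path_end p") (auto simp: path_end_snoc)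
qed

lemma enclosed_region_snoc_Rightstep:
  "enclosed_region f l (p @ [Rightstep]) = enclosed_region f l p"
  by (simp add: enclosed_region_def path_trace_snoc_Rightstep)

lemma enclosed_region_Nil: "negligible (enclosed_region f 0 [])"
  by (rule negligible_subset[OF negligible_horizontal_line[of 0]])
    (auto simp: enclosed_region_def path_trace_eq)

lemma enclosed_region_lmeasurable:
  assumes "f \<ge> 1"
  shows "stays_below f p \<Longrightarrow> path_end p = (X, real l) \<Longrightarrow> enclosed_region f l p \<in> lmeasurable"
proof (induction p arbitrary: X l rule: rev_induct)
  case Nil
  then show ?case using enclosed_region_Nil by (simp add: negligible_imp_measurable)
next
  case (snoc s p)
  have below: "stays_below f p" using snoc.prems by (simp add: stays_below_snoc)
  show ?case
  proof (cases "s = Rightstep")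
    case True
    then have "path_end p = (X - 1, real l)"
      using snoc.prems by (cases "path_end p") (auto simp: path_end_snoc)
    then show ?thesis using snoc.IH[OF below] True by (simp add: enclosed_region_snoc_Rightstep)
  next
    case False
    then obtain \<sigma> where s: "displacement s = (\<sigma>, 1)" by (cases s) auto
    from snoc.prems(2) s obtain l' where l': "l = Suc l'" "path_end p = (X - \<sigma>, real l')"
      by (rule rising_last_stepE)
    then show ?thesis
      using enclosed_region_rising_step(1)[OF assms snoc.prems(1) s l'(2)] snoc.IH[OF below l'(2)]
      by simp
  qed
qed

lemma Nil_mem_schroeder_paths:
  assumes "f \<ge> 1"
  shows "[] \<in> schroeder_paths f (Suc d) i j l \<longleftrightarrow> d = 0 \<and> i = 0 \<and> j = 0 \<and> l = 0"
proof -
  have "stays_below f []" by (simp add: stays_below_iff half_plane_def)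
  moreover have "enclosed_area f 0 [] = 0"
    using enclosed_region_Nil by (simp add: enclosed_area_def negligible_imp_measure0)
  moreover have "real f * real l + real d = 0 \<longleftrightarrow> l = 0 \<and> d = 0"
    using assms by (auto simp: add_nonneg_eq_0_iff)
  ultimately show ?thesis
    by (auto simp: schroeder_paths_def)
qed

lemma snoc_Rightstep_mem_schroeder_paths:
  "p @ [Rightstep] \<in> schroeder_paths f (Suc d) i j l \<longleftrightarrow> p \<in> schroeder_paths f d i j l"
proof -
  have "path_end (p @ [Rightstep]) = (x, y) \<longleftrightarrow> path_end p = (x - 1, y)" for x y
    by (cases "path_end p") (auto simp: path_end_snoc)
  then show ?thesis
    by (simp add: schroeder_paths_def stays_below_def path_trace_snoc_Rightstep
        enclosed_area_def enclosed_region_snoc_Rightstep)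
qed

text \<open>The numerical content of the last step. Let the new end be at horizontal distance \<open>d\<close> from the
  line. Before the step the distance was \<open>d + f - \<sigma>\<close>, since the line recedes by \<open>f\<close> per unit
  of height, and the slab between line and step has area \<open>d + (f - \<sigma>) / 2\<close>; this is the
  mean of the two distances. A diagonal step also counts twice in the exponent of \<open>a\<close>.\<close>

lemma snoc_rising_mem_schroeder_paths:
  assumes f: "f \<ge> 1"
    and s: "displacement s = (real \<sigma>, 1)" "count_list [s] Diagstep = \<sigma>" "\<sigma> \<le> 1"
  shows "p @ [s] \<in> schroeder_paths f (Suc d) i j l \<longleftrightarrow>
    (\<exists>l' i' j'. l = Suc l' \<and> i = i' + 2 * \<sigma> \<and> j = j' + (2 * d + f - \<sigma>) \<and>
       p \<in> schroeder_paths f (Suc (d + f) - \<sigma>) i' j' l')"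
    (is "?L \<longleftrightarrow> ?R")
proof -
  define x where "x l' = real f * real l' + real (Suc (d + f) - \<sigma>) - 1" for l'
  have x: "x l' = real f * real (Suc l') + real d - real \<sigma>" for l'
    using f s(3) by (simp add: x_def of_nat_diff algebra_simps)
  have j: "real (2 * d + f - \<sigma>) = 2 * real d + real f - real \<sigma>"
    using f s(3) by (simp add: of_nat_diff)
  have below: "stays_below f (p @ [s]) \<longleftrightarrow> stays_below f p" if "path_end p = (x l', real l')" for l'
    using f that by (simp add: stays_below_snoc path_end_snoc s x half_plane_def field_simps)
  have area: "enclosed_area f (Suc l') (p @ [s]) = enclosed_area f l' p + real (2 * d + f - \<sigma>) / 2"
    if "path_end p = (x l', real l')" "stays_below f p" for l'
  proof -
    have "enclosed_region f l' p \<in> lmeasurable"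
      using enclosed_region_lmeasurable[OF f that(2,1)] .
    then have "enclosed_area f (Suc l') (p @ [s]) =
        enclosed_area f l' p + x l' + real \<sigma> / 2 - real f * (real l' + 1 / 2)"
      using enclosed_region_rising_step(2)[OF f _ s(1) that(1)] below[OF that(1)] that(2) by simp
    then show ?thesis unfolding x j by (simp add: field_simps)
  qed
  have count: "count_list (p @ [s]) Diagstep = count_list p Diagstep + \<sigma>"
    using s(2) by simp
  show ?thesis
  proof
    assume L: ?L
    then have "path_end (p @ [s]) = (real f * real l + real d, real l)"
      by (simp add: schroeder_paths_def)
    from this s(1) obtain l' where l': "l = Suc l'"
      and "path_end p = (real f * real l + real d - real \<sigma>, real l')"
      by (rule rising_last_stepE)
    then have e: "path_end p = (x l', real l')" by (simp add: x)
    have b: "stays_below f p" using L below[OF e] by (simp add: schroeder_paths_def)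
    have "real (count_list p Diagstep) + real \<sigma> = real i / 2"
      using L count by (simp add: schroeder_paths_def)
    then have "real i = real (2 * count_list p Diagstep + 2 * \<sigma>)" by simp
    then have i: "i = 2 * count_list p Diagstep + 2 * \<sigma>" by linarith
    have a: "enclosed_area f l' p + real (2 * d + f - \<sigma>) / 2 = real j / 2"
      using L area[OF e b] by (simp add: schroeder_paths_def l')
    \<comment> \<open>Nonnegativity of the old area makes the doubled area a natural number again.\<close>
    moreover have "0 \<le> enclosed_area f l' p" by (simp add: enclosed_area_def)
    ultimately have le: "2 * d + f - \<sigma> \<le> j" by linarith
    then have "enclosed_area f l' p = real (j - (2 * d + f - \<sigma>)) / 2"
      using a by (simp add: of_nat_diff field_simps)
    then have "p \<in> schroeder_paths f (Suc (d + f) - \<sigma>) (2 * count_list p Diagstep) (j - (2 * d + f - \<sigma>)) l'"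
      using e b by (simp add: schroeder_paths_def x_def)
    with l' i le show ?R by (metis le_add_diff_inverse2)
  next
    assume ?R
    then obtain l' i' j' where *: "l = Suc l'" "i = i' + 2 * \<sigma>" "j = j' + (2 * d + f - \<sigma>)"
      and p: "p \<in> schroeder_paths f (Suc (d + f) - \<sigma>) i' j' l'" by blast
    have e: "path_end p = (x l', real l')" and b: "stays_below f p"
      using p by (simp_all add: schroeder_paths_def x_def)
    have "path_end (p @ [s]) = (real f * real l + real (Suc d) - 1, real l)"
      using e by (simp add: path_end_snoc s x *)
    moreover have "real (count_list (p @ [s]) Diagstep) = real i / 2"
      using p unfolding count by (simp add: schroeder_paths_def *)
    moreover have "enclosed_area f l (p @ [s]) = real j / 2"
      using p area[OF e b] by (simp add: schroeder_paths_def * add_divide_distrib)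
    ultimately show ?L using b below[OF e] by (simp add: schroeder_paths_def)
  qed
qed

text \<open>For \<open>k = 0\<close> the prescribed end point lies strictly above the line. The empty family is the
  natural start of the recursion in \<open>k\<close>.\<close>

lemma schroeder_paths_0: "f \<ge> 1 \<Longrightarrow> schroeder_paths f 0 i j l = {}"
  by (auto simp: schroeder_paths_def stays_below_iff half_plane_def field_simps)

lemma finite_schroeder_paths: "finite (schroeder_paths f k i j l)"
proof -
  have "s \<in> {Rightstep, Upstep, Diagstep}" for s
    by (cases s) auto
  then have fin: "finite (UNIV :: step set)"
    by (intro finite_subset[of UNIV "{Rightstep, Upstep, Diagstep}"]) auto
  have "length p \<le> f * l + k + l" if "p \<in> schroeder_paths f k i j l" for p
  proof -
    have "real (length p) \<le> real (f * l + k + l)"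
      using length_le_path_end[of p] that by (simp add: schroeder_paths_def)
    then show ?thesis by linarith
  qed
  then have "schroeder_paths f k i j l \<subseteq> {p. set p \<subseteq> UNIV \<and> length p \<le> f * l + k + l}"
    by auto
  then show ?thesis using finite_lists_length_le[OF fin] finite_subset by blast
qed

lemma card_by_last_step:
  assumes "finite A"
  shows "card A = (if [] \<in> A then 1 else 0) + card {p. p @ [Rightstep] \<in> A} +
    card {p. p @ [Upstep] \<in> A} + card {p. p @ [Diagstep] \<in> A}"
proof -
  let ?E = "\<lambda>s. (\<lambda>p. p @ [s]) ` {p. p @ [s] \<in> A}"
  have fin: "finite (?E s)" for s
    by (rule finite_subset[OF _ assms]) auto
  have c: "card (?E s) = card {p. p @ [s] \<in> A}" for s
    by (rule card_image) (simp add: inj_on_def)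
  have A: "A = ({[]} \<inter> A) \<union> ?E Rightstep \<union> ?E Upstep \<union> ?E Diagstep" (is "_ = ?B")
  proof
    show "A \<subseteq> ?B"
    proof
      fix p assume p: "p \<in> A"
      show "p \<in> ?B"
      proof (cases p rule: rev_cases)
        case (snoc p' s)
        then show ?thesis using p by (cases s) auto
      qed (use p in auto)
    qed
  qed auto
  have "card ?B = card ({[]} \<inter> A) + card (?E Rightstep) + card (?E Upstep) + card (?E Diagstep)"
    by (subst card_Un_disjoint; (use fin in force)?)+
  then show ?thesis using A by (simp add: c)
qed

text \<open>The summands are the empty path and the paths ending in a right step, in an up step
  (\<open>\<sigma> = 0\<close>) and in a diagonal step (\<open>\<sigma> = 1\<close>).\<close>

lemma num_schroeder_paths_rec:
  fixes f d i j l :: nat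
  assumes "f \<ge> 1"
  defines "rise \<equiv> \<lambda>\<sigma>. if l = 0 \<or> i < 2 * \<sigma> \<or> j < 2 * d + f - \<sigma> then 0
    else num_schroeder_paths f (Suc (d + f) - \<sigma>) (i - 2 * \<sigma>) (j - (2 * d + f - \<sigma>)) (l - 1)"
  shows "num_schroeder_paths f (Suc d) i j l =
    (if d = 0 \<and> i = 0 \<and> j = 0 \<and> l = 0 then 1 else 0) + num_schroeder_paths f d i j l +
    rise 0 + rise 1"
proof -
  let ?A = "schroeder_paths f (Suc d) i j l"
  have ex_add: "(\<exists>y. x = y + m \<and> Q y) \<longleftrightarrow> \<not> x < m \<and> Q (x - m)" for x m :: nat and Q
    by (metis add_diff_cancel_right' le_add2 le_add_diff_inverse2 not_less)
  have rise: "card {p. p @ [s] \<in> ?A} = rise \<sigma>"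
    if s: "displacement s = (real \<sigma>, 1)" "count_list [s] Diagstep = \<sigma>" "\<sigma> \<le> 1" for s \<sigma>
  proof -
    have "{p. p @ [s] \<in> ?A} = (if l = 0 \<or> i < 2 * \<sigma> \<or> j < 2 * d + f - \<sigma> then {}
      else schroeder_paths f (Suc (d + f) - \<sigma>) (i - 2 * \<sigma>) (j - (2 * d + f - \<sigma>)) (l - 1))"
      unfolding snoc_rising_mem_schroeder_paths[OF assms(1) s]
      by (cases l) (auto simp: ex_add)
    then show ?thesis by (simp add: rise_def num_schroeder_paths_def)
  qed
  show ?thesis
    using card_by_last_step[OF finite_schroeder_paths[of f "Suc d" i j l]]
      rise[of Upstep 0] rise[of Diagstep 1]
    by (simp add: num_schroeder_paths_def Nil_mem_schroeder_paths[OF assms(1)]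
        snoc_Rightstep_mem_schroeder_paths)
qed

section \<open>The recursion for the generating functions of paths\<close>

lemma fls_X_power_times_fps_nth:
  fixes F :: "nat \<Rightarrow> 'a::comm_ring_1"
  shows "fls_X ^ m * fps_to_fls (Abs_fps F) =
    fps_to_fls (Abs_fps (\<lambda>j. if j < m then 0 else F (j - m)))"
proof -
  have "fls_X ^ m * fps_to_fls (Abs_fps F) = fps_to_fls (fps_X ^ m * Abs_fps F)"
    by (simp add: fls_times_fps_to_fls fps_to_fls_power)
  also have "fps_X ^ m * Abs_fps F = Abs_fps (\<lambda>j. if j < m then 0 else F (j - m))"
    by (rule fps_ext) (simp add: fps_X_power_mult_nth)
  finally show ?thesis .
qed

lemma fls_const_times_fps_to_fls:
  fixes F :: "nat \<Rightarrow> 'a::comm_ring_1"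
  shows "fls_const c * fps_to_fls (Abs_fps F) = fps_to_fls (Abs_fps (\<lambda>j. c * F j))"
  by (rule fls_eqI) simp

definition bivariate_series :: "(nat \<Rightarrow> nat \<Rightarrow> nat) \<Rightarrow> coeff" where
  "bivariate_series N =
     fps_to_fls (Abs_fps (\<lambda>j. fps_to_fls (Abs_fps (\<lambda>i. of_nat (N i j)))))"

lemma bivariate_series_add:
  "bivariate_series (\<lambda>i j. N i j + M i j) = bivariate_series N + bivariate_series M"
proof -
  have add: "fps_to_fls (Abs_fps (\<lambda>j. F j + H j)) = fps_to_fls (Abs_fps F) + fps_to_fls (Abs_fps H)"
    for F H :: "nat \<Rightarrow> 'a::comm_ring_1"
    by (rule fls_eqI) simp
  show ?thesis by (simp add: bivariate_series_def add)
qed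

lemma bivariate_series_0: "bivariate_series (\<lambda>i j. 0) = 0"
  by (simp add: bivariate_series_def flip: fps_zero_def)

lemma bivariate_series_1: "bivariate_series (\<lambda>i j. if i = 0 \<and> j = 0 then 1 else 0) = 1"
  by (intro fls_eqI) (auto simp: bivariate_series_def fls_one_nth)

lemma bivariate_series_shift:
  "a_var ^ m * q_var ^ n * bivariate_series N =
     bivariate_series (\<lambda>i j. if i < m \<or> j < n then 0 else N (i - m) (j - n))"
proof -
  have a: "a_var ^ m = fls_const (fls_X ^ m)"
    by (induction m) (simp_all add: a_var_def fls_const_mult_const)
  have "a_var ^ m * q_var ^ n * bivariate_series N = fps_to_fls (Abs_fps (\<lambda>j. if j < n then 0 else
      fls_X ^ m * fps_to_fls (Abs_fps (\<lambda>i. of_nat (N i (j - n))))))"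
    unfolding a q_var_def bivariate_series_def mult.assoc fls_X_power_times_fps_nth fls_const_times_fps_to_fls
    by (intro arg_cong[where f = fps_to_fls] fps_ext) (simp add: fls_X_power_times_fps_nth)
  also have "\<dots> = bivariate_series (\<lambda>i j. if i < m \<or> j < n then 0 else N (i - m) (j - n))"
    unfolding bivariate_series_def fls_X_power_times_fps_nth
    by (intro arg_cong[where f = fps_to_fls] fps_ext) (auto intro!: fps_ext)
  finally show ?thesis .
qed

lemma schroeder_gf_nth:
  "fps_nth (schroeder_gf f k) l = bivariate_series (\<lambda>i j. num_schroeder_paths f k i j l)"
  by (simp add: schroeder_gf_def bivariate_series_def)

lemma schroeder_gf_0: "f \<ge> 1 \<Longrightarrow> schroeder_gf f 0 = 0"
  by (rule fps_ext)
    (simp add: schroeder_gf_nth num_schroeder_paths_def schroeder_paths_0 bivariate_series_0)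

text \<open>The count by the last step in terms of series: the shifts of \<open>i\<close>, \<open>j\<close> and \<open>l\<close> become factors
  \<open>a\<close>, \<open>q\<close> and \<open>x\<close>. Apart from the empty path this is the equation of the lemma
  \<open>scaled_superpoly_Suc\<close>.\<close>

lemma schroeder_gf_Suc:
  assumes "f \<ge> 1"
  shows "schroeder_gf f (Suc k) = schroeder_gf f k + (if k = 0 then 1 else 0) +
    fps_X * (fps_const (q_var ^ (2 * k + f)) * schroeder_gf f (Suc (k + f)) +
             fps_const (a_var ^ 2 * q_var ^ (2 * k + f - 1)) * schroeder_gf f (k + f))"
proof (rule fps_ext)
  fix l
  show "fps_nth (schroeder_gf f (Suc k)) l = fps_nth (schroeder_gf f k + (if k = 0 then 1 else 0) +
    fps_X * (fps_const (q_var ^ (2 * k + f)) * schroeder_gf f (Suc (k + f)) +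
             fps_const (a_var ^ 2 * q_var ^ (2 * k + f - 1)) * schroeder_gf f (k + f))) l"
  proof (cases l)
    case 0
    have "fps_nth (schroeder_gf f (Suc k)) 0 =
        bivariate_series (\<lambda>i j. if i = 0 \<and> j = 0 then if k = 0 then 1 else 0 else 0) + fps_nth (schroeder_gf f k) 0"
      unfolding schroeder_gf_nth bivariate_series_add[symmetric]
      by (intro arg_cong[where f = bivariate_series] ext)
        (simp add: num_schroeder_paths_rec[OF assms])
    then show ?thesis
      using 0 by (cases "k = 0") (simp_all add: bivariate_series_1 bivariate_series_0)
  next
    case (Suc l')
    have "fps_nth (schroeder_gf f (Suc k)) l = fps_nth (schroeder_gf f k) l +
        a_var ^ 0 * q_var ^ (2 * k + f) * fps_nth (schroeder_gf f (Suc (k + f))) l' +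
        a_var ^ 2 * q_var ^ (2 * k + f - 1) * fps_nth (schroeder_gf f (k + f)) l'"
      unfolding schroeder_gf_nth bivariate_series_add[symmetric] bivariate_series_shift
      by (intro arg_cong[where f = bivariate_series] ext)
        (simp add: num_schroeder_paths_rec[OF assms] Suc)
    then show ?thesis by (simp add: Suc)
  qed
qed

section \<open>The recursion for the superpolynomials\<close>

lemma q_var_nonzero: "q_var \<noteq> 0" by (simp add: q_var_def)

lemma one_minus_q_power_nonzero: "m > 0 \<Longrightarrow> 1 - q_var ^ m \<noteq> 0"
proof
  assume m: "m > 0" and "1 - q_var ^ m = 0"
  then have "fls_nth (1 - q_var ^ m) 0 = fls_nth (0::coeff) 0" by simp
  then show False using m by (simp add: q_var_def fls_X_power_nth)
qed

definition scaled_superpoly :: "nat \<Rightarrow> nat \<Rightarrow> coeff fps" where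
  "scaled_superpoly f k =
     superpoly_gf f oo (fps_const (q_var powi (2 * int k - 1)) * fps_X)"

lemma scaled_superpoly_nth:
  "fps_nth (scaled_superpoly f k) n = (q_var powi (2 * int k - 1)) ^ n * superpoly_coeff f n"
  by (simp add: scaled_superpoly_def fps_compose_linear superpoly_gf_def)

text \<open>The functional equation \<open>P(q\<^sup>2 z) = P(z) + ...\<close> satisfied by the superpolynomial series.
  Comparing coefficients of \<open>x^(r+1)\<close> and cancelling the common power of
  \<open>w = q^(2k-1)\<close>, it is the defining two-term recursion of the coefficients, cleared of its
  denominator \<open>1 - q^(2r+2)\<close>.\<close>

lemma scaled_superpoly_Suc:
  assumes "f \<ge> 1"
  shows "scaled_superpoly f (Suc k) = scaled_superpoly f k +
    fps_X * (fps_const (q_var ^ (2 * k + f)) * scaled_superpoly f (Suc (k + f)) +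
             fps_const (a_var ^ 2 * q_var ^ (2 * k + f - 1)) * scaled_superpoly f (k + f))"
    (is "?lhs = ?rhs")
proof (rule fps_ext)
  fix n
  define w where "w = q_var powi (2 * int k - 1)"
  define q where "q = q_var"
  have qnz: "q \<noteq> 0" by (simp add: q_def q_var_nonzero)
  have shift: "q_var powi (2 * int (k + m) - 1) = w * q ^ (2 * m)" for m
  proof -
    have "2 * int (k + m) - 1 = (2 * int k - 1) + int (2 * m)" by simp
    then show ?thesis
      unfolding w_def q_def by (simp only: power_int_add q_var_nonzero power_int_of_nat simp_thms disj_not1)
  qed
  have wq: "q ^ (2 * k) = w * q"
  proof -
    have "w * q = q_var powi (2 * int k - 1 + 1)"
      unfolding w_def q_def by (subst power_int_add) (auto simp: q_var_nonzero)
    also have "\<dots> = q_var powi (int (2 * k))" by simp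
    finally show ?thesis by (simp only: power_int_of_nat q_def)
  qed
  have e1: "q ^ (2 * k + f) = w * q * q ^ f" by (simp add: power_add wq)
  \<comment> \<open>The truncated subtraction is harmless because \<open>f \<ge> 1\<close>.\<close>
  have e2: "q ^ (2 * k + f - 1) = w * q ^ f"
  proof -
    have "q * q ^ (2 * k + f - 1) = q ^ (2 * k + f)"
      using assms by (cases "2 * k + f") auto
    then have "q * q ^ (2 * k + f - 1) = q * (w * q ^ f)" by (simp add: e1)
    then show ?thesis using qnz by simp
  qed
  show "fps_nth ?lhs n = fps_nth ?rhs n"
  proof (cases n)
    case 0
    then show ?thesis by (simp add: scaled_superpoly_nth)
  next
    case (Suc r)
    define P where "P = superpoly_coeff f r"
    have clear: "x * (C - 1) = A * B * P"
      if "x = - A * (B / (1 - C)) * P" "1 - C \<noteq> 0" for x A B C :: coeff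
    proof -
      have "x * (1 - C) = - A * B * P" using that by simp
      then show ?thesis by (simp add: algebra_simps)
    qed
    have rec: "superpoly_coeff f (Suc r) * (q ^ (2 * r + 2) - 1) =
        q ^ ((2 * r + 1) * f) * (a_var ^ 2 + q ^ (2 * r + 1)) * P"
      by (rule clear) (use one_minus_q_power_nonzero[of "2 * r + 2"] in \<open>simp_all add: P_def q_def\<close>)
    have "fps_nth ?lhs n - fps_nth (scaled_superpoly f k) n =
        w ^ Suc r * (superpoly_coeff f (Suc r) * (q ^ (2 * r + 2) - 1))"
      using shift[of 1] shift[of 0] unfolding Suc scaled_superpoly_nth
      by (simp add: power_mult_distrib power_mult power2_eq_square algebra_simps del: superpoly_coeff.simps)
    also have "\<dots> = w ^ Suc r * (q ^ ((2 * r + 1) * f) * (a_var ^ 2 + q ^ (2 * r + 1)) * P)"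
      by (simp only: rec)
    also have "\<dots> = (w * q * q ^ f) * ((w * q ^ (2 * (f + 1))) ^ r * P) +
        (a_var ^ 2 * (w * q ^ f)) * ((w * q ^ (2 * f)) ^ r * P)"
      by (simp add: power_mult_distrib power_add mult_2 mult_2_right algebra_simps flip: power_mult)
    also have "\<dots> = fps_nth ?rhs n - fps_nth (scaled_superpoly f k) n"
      using shift[of "Suc f"] shift[of f] e1 e2
      by (simp add: Suc scaled_superpoly_nth P_def q_def mult.assoc)
    finally show ?thesis by (metis diff_add_cancel)
  qed
qed

section \<open>Comparing the two families\<close>

text \<open>The recursion determines each coefficient of \<open>D (Suc k)\<close> from the same coefficient of \<open>D k\<close>
  and from lower coefficients of other members of the family: an induction on the coefficient,
  with one on \<open>k\<close> inside. Induction on \<open>k\<close> alone would fail, since in the application \<open>u k\<close> and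
  \<open>v k\<close> are at least as large as \<open>k + 1\<close>.\<close>

lemma fps_recursion_zero:
  fixes D :: "nat \<Rightarrow> 'a::comm_ring_1 fps"
  assumes "D 0 = 0"
    and rec: "\<And>k. D (Suc k) = D k + fps_X * (\<alpha> k * D (u k) + \<beta> k * D (v k))"
  shows "D k = 0"
proof -
  have "\<forall>k. \<forall>m\<le>n. fps_nth (D k) m = 0" for n
  proof (induction n)
    case 0
    have "fps_nth (D k) 0 = 0" for k
      by (induction k) (simp_all add: assms)
    then show ?case by simp
  next
    case (Suc n)
    have "fps_nth (c * D k) n = 0" for c k
      using Suc by (simp add: fps_mult_nth)
    then have "fps_nth (fps_X * (\<alpha> k * D (u k) + \<beta> k * D (v k))) (Suc n) = 0" for k
      by simp
    then have "fps_nth (D k) (Suc n) = 0" for k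
      by (induction k) (simp_all add: assms(1) rec)
    then show ?case using Suc by (auto simp: le_Suc_eq)
  qed
  then show ?thesis by (intro fps_ext) auto
qed

lemma schroeder_gf_times_scaled_superpoly:
  assumes "f \<ge> 1" and "k \<ge> 1"
  shows "schroeder_gf f k * scaled_superpoly f 0 = scaled_superpoly f k"
proof -
  define D where "D k = (schroeder_gf f k + (if k = 0 then 1 else 0)) * scaled_superpoly f 0 -
    scaled_superpoly f k" for k
  \<comment> \<open>Adding \<open>1\<close> at \<open>k = 0\<close> absorbs the empty path, so that the recursion becomes homogeneous. It
    leaves the other terms unchanged since \<open>k + f \<ge> 1\<close>.\<close>
  have "D k = 0"
  proof (rule fps_recursion_zero)
    show "D 0 = 0" by (simp add: D_def schroeder_gf_0[OF assms(1)])
    show "D (Suc k) = D k + fps_X * (fps_const (q_var ^ (2 * k + f)) * D (Suc (k + f)) +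
        fps_const (a_var ^ 2 * q_var ^ (2 * k + f - 1)) * D (k + f))" for k
      using assms(1) unfolding D_def schroeder_gf_Suc[OF assms(1), of k] scaled_superpoly_Suc[OF assms(1), of k]
      by (simp add: algebra_simps del: fps_const_mult)
  qed
  then show ?thesis using assms(2) by (simp add: D_def)
qed

theorem proposition1p3:
  fixes f i :: nat
  assumes "f \<ge> 1" and "1 \<le> i" and "i \<le> f + 1"
  shows "schroeder_gf f i =
    (superpoly_gf f oo (fps_const (q_var powi (2 * int i - 1)) * fps_X)) /
    (superpoly_gf f oo (fps_const (q_var powi (-1)) * fps_X))"
proof -
  have "fps_nth (scaled_superpoly f 0) 0 = 1"
    by (simp add: scaled_superpoly_nth)
  then have "scaled_superpoly f 0 \<noteq> 0" by auto
  then have "schroeder_gf f i = scaled_superpoly f i / scaled_superpoly f 0"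
    using schroeder_gf_times_scaled_superpoly[OF assms(1,2)] by (metis nonzero_mult_div_cancel_right)
  then show ?thesis by (simp add: scaled_superpoly_def)
qed

end
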